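(* Let $\epsilon_{\mathrm{rad}}\ge1$, $\epsilon_{\mathrm{geo}}>0$, $0<\Delta_{\min}\le\Delta_{\max}$ and $\Delta_k\in[\Delta_{\min},\Delta_{\max}]$. Suppose $f:\mathbb{R}^n\to\mathbb{R}$ is in $\mathcal{C}^{2+}$ with Lipschitz constant $L_{\nabla^2 f}$. Suppose $D_k\in\mathbb{R}^{n\times p}$ has full-column rank and let $x_k\in\mathbb{R}^n$. Suppose the $QR$-factorization of $D_k$ is $D_k=Q_kR_k$, where $Q_k\in\mathbb{R}^{n\times p}$ and $R_k=[r_1\cdots r_p]\in\mathbb{R}^{p\times p}$, and suppose that, with $\overline{\mathrm{diam}}(R_k)=\max_{1\le i\le p}\|r_i\|$, $$\Delta_k\le\overline{\mathrm{diam}}(R_k)\le\epsilon_{\mathrm{rad}}\Delta_k,\qquad \|D_k^\dagger\|\le\max\left\{\frac1{\epsilon_{\mathrm{geo}}},\frac1{\Delta_{\min}}\right\}.$$ Let $\widehat f(\widehat s)=f(x_k+Q_k\widehat s)$ and $$\widehat m_k(\widehat s)=\widehat f(\mathbf 0)+\left(2\nabla_S\widehat f(\mathbf 0;R_k)-\nabla_S\widehat f(\mathbf 0;2R_k)\right)^\top\widehat s+\frac12\widehat s^\top\nabla_S^2\widehat f(\mathbf 0;R_k)\widehat s,\qquad \widehat s\in\mathbb{R}^p.$$ Then $\widehat m_k$ belongs to a class of $Q_k$-fully quadratic models of $f$ at $x_k$ parameterized by $\Delta_k\in(0,\Delta_{\max}]$ with the following constants (which do not depend on $k$): $$\kappa_{ef}=\left(\sqrt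 p\,L_{\nabla^2 f}M_{\widehat R^{-\top}}\left(6pM_{\widehat R^{-\top}}^2+2\sqrt p\,M_{\widehat R^{-\top}}+3\right)+\frac23L_{\nabla^2 f}\right)\epsilon_{\mathrm{rad}}^3,$$ $$\kappa_{eg}=3\sqrt p\,L_{\nabla^2 f}M_{\widehat R^{-\top}}\left(2pM_{\widehat R^{-\top}}^2+1\right)\epsilon_{\mathrm{rad}}^2,\qquad \kappa_{eh}=L_{\nabla^2 f}\left(4pM_{\widehat R^{-\top}}^2+1\right)\epsilon_{\mathrm{rad}},$$ where $M_{\widehat R^{-\top}}=\max\{1/\epsilon_{\mathrm{geo}},1/\Delta_{\min}\}\,\epsilon_{\mathrm{rad}}\Delta_{\max}$.
   Context: $\|\cdot\|$ is the Euclidean vector norm and induced matrix norm; $A^\dagger$ is the Moore–Penrose pseudoinverse. $f\in\mathcal{C}^{2+}$ with Lipschitz constant $L_{\nabla^2 f}$ means $f$ is twice continuously differentiable and $\nabla^2 f$ is Lipschitz continuous with constant $L_{\nabla^2 f}$. In the $QR$-factorization, $Q_k$ has orthonormal columns and $R_k$ is upper triangular. Definition ($Q$-fully quadratic). Given $f\in\mathcal{C}^2$, $x\in\mathbb{R}^n$, $\bar\Delta>0$ and $Q\in\mathbb{R}^{n\times p}$, a family $\{\widehat m_\Delta:\mathbb{R}^p\to\mathbb{R}\}_{\Delta\in(0,\bar\Delta]}$ is a class of $Q$-fully quadratic models of $f$ at $x$ parameterized by $\Delta$, with constants $\kappa_{ef},\kappa_{eg},\kappa_{eh}>0$, if for all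 $\Delta\in(0,\bar\Delta]$ and $\widehat s\in\mathbb{R}^p$ with $\|\widehat s\|\le\Delta$: $|f(x+Q\widehat s)-\widehat m_\Delta(\widehat s)|\le\kappa_{ef}\Delta^3$, $\|Q^\top\nabla f(x+Q\widehat s)-\nabla\widehat m_\Delta(\widehat s)\|\le\kappa_{eg}\Delta^2$, and $\|Q^\top\nabla^2 f(x+Q\widehat s)Q-\nabla^2\widehat m_\Delta(\widehat s)\|\le\kappa_{eh}\Delta$. That $\widehat m_k$ belongs to such a class means that it is the member with parameter $\Delta=\Delta_k$, i.e. it satisfies these three bounds with $Q=Q_k$, $x=x_k$, $\Delta=\Delta_k$. For $g:\mathbb{R}^p\to\mathbb{R}$, $y\in\mathbb{R}^p$ and $M=[m_1\cdots m_z]\in\mathbb{R}^{p\times z}$: $\delta_g(y;M)\in\mathbb{R}^z$ has $i$-th entry $g(y+m_i)-g(y)$; $\nabla_S g(y;M)=(M^\top)^\dagger\delta_g(y;M)$ (generalized simplex gradient); $\delta_{\nabla_S g}(y;M)\in\mathbb{R}^{z\times p}$ has $i$-th row $(\nabla_S g(y+m_i;M)-\nabla_S g(y;M))^\top$; $\nabla_S^2 g(y;M)=(M^\top)^\dagger\delta_{\nabla_S g}(y;M)$ (generalized simplex Hessian). *)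

theory Defs
  imports "HOL-Analysis.Analysis"
begin

(* The library norm on real^'n^'m is the Frobenius norm; the spectral norm
   is the operator norm of the associated linear map. *)
definition spectral_norm :: "real^'n^'m \<Rightarrow> real" where
  "spectral_norm A = onorm (\<lambda>v. A *v v)"

(* The unique matrix satisfying the four Penrose conditions. *)
definition pseudoinverse :: "real^'n^'m \<Rightarrow> real^'m^'n" where
  "pseudoinverse A = (THE X. A ** X ** A = A \<and> X ** A ** X = X \<and>
     transpose (A ** X) = A ** X \<and> transpose (X ** A) = X ** A)"

definition gradient :: "('a::real_inner \<Rightarrow> real) \<Rightarrow> 'a \<Rightarrow> 'a" where
  "gradient f x = (THE D. GDERIV f x :> D)"

definition hessian :: "(real^'n \<Rightarrow> real) \<Rightarrow> real^'n \<Rightarrow> real^'n^'n" where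
  "hessian f x = jacobian (gradient f) (at x)"

definition C2 :: "(real^'n \<Rightarrow> real) \<Rightarrow> bool" where
  "C2 f \<longleftrightarrow> (\<forall>x. f differentiable at x) \<and> (\<forall>x. gradient f differentiable at x) \<and>
     continuous_on UNIV (hessian f)"

definition C2_plus :: "(real^'n \<Rightarrow> real) \<Rightarrow> real \<Rightarrow> bool" where
  "C2_plus f L \<longleftrightarrow> C2 f \<and> 0 \<le> L \<and>
     (\<forall>x y. spectral_norm (hessian f x - hessian f y) \<le> L * norm (x - y))"

definition is_QR_factorization ::
  "real^('p::{finite,linorder})^'n \<Rightarrow> real^('p::{finite,linorder})^'n \<Rightarrow>
   real^('p::{finite,linorder})^('p::{finite,linorder}) \<Rightarrow> bool" where
  "is_QR_factorization D Q R \<longleftrightarrow>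
     D = Q ** R \<and> transpose Q ** Q = mat 1 \<and> (\<forall>i j. j < i \<longrightarrow> R $ i $ j = 0)"

definition diam_bar :: "real^'z^'p \<Rightarrow> real" where
  "diam_bar M = Max (range (\<lambda>i. norm (column i M)))"

definition delta :: "(real^'p \<Rightarrow> real) \<Rightarrow> real^'p \<Rightarrow> real^'z^'p \<Rightarrow> real^'z" where
  "delta g y M = (\<chi> i. g (y + column i M) - g y)"

definition simplex_gradient :: "(real^'p \<Rightarrow> real) \<Rightarrow> real^'p \<Rightarrow> real^'z^'p \<Rightarrow> real^'p" where
  "simplex_gradient g y M = pseudoinverse (transpose M) *v delta g y M"

definition delta_simplex_gradient ::
  "(real^'p \<Rightarrow> real) \<Rightarrow> real^'p \<Rightarrow> real^'z^'p \<Rightarrow> real^'p^'z" where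
  "delta_simplex_gradient g y M =
     (\<chi> i. simplex_gradient g (y + column i M) M - simplex_gradient g y M)"

definition simplex_hessian :: "(real^'p \<Rightarrow> real) \<Rightarrow> real^'p \<Rightarrow> real^'z^'p \<Rightarrow> real^'p^'p" where
  "simplex_hessian g y M = pseudoinverse (transpose M) ** delta_simplex_gradient g y M"

definition simplex_model :: "(real^'p \<Rightarrow> real) \<Rightarrow> real^'z^'p \<Rightarrow> real^'p \<Rightarrow> real" where
  "simplex_model g R s = g 0
     + (2 *\<^sub>R simplex_gradient g 0 R - simplex_gradient g 0 (2 *\<^sub>R R)) \<bullet> s
     + 1 / 2 * (s \<bullet> (simplex_hessian g 0 R *v s))"

(* m is the member with parameter \<Delta> of a class of Q-fully quadratic models of f at x
   parameterized over (0, \<Delta>bar].  The condition C2 m ensures that the gradient and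
   the Hessian of m are the actual derivatives. *)
definition Q_fully_quadratic_member ::
  "(real^'n \<Rightarrow> real) \<Rightarrow> real^'n \<Rightarrow> real^'p^'n \<Rightarrow> real \<Rightarrow> real \<Rightarrow> real \<Rightarrow> real \<Rightarrow> real \<Rightarrow>
   (real^'p \<Rightarrow> real) \<Rightarrow> bool" where
  "Q_fully_quadratic_member f x Q \<Delta>bar \<kappa>ef \<kappa>eg \<kappa>eh \<Delta> m \<longleftrightarrow>
     \<Delta> \<in> {0<..\<Delta>bar} \<and> C2 m \<and>
     (\<forall>s. norm s \<le> \<Delta> \<longrightarrow>
        \<bar>f (x + Q *v s) - m s\<bar> \<le> \<kappa>ef * \<Delta> ^ 3 \<and>
        norm (transpose Q *v gradient f (x + Q *v s) - gradient m s) \<le> \<kappa>eg * \<Delta>\<^sup>2 \<and>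
        spectral_norm (transpose Q ** hessian f (x + Q *v s) ** Q - hessian m s) \<le> \<kappa>eh * \<Delta>)"

end

theory Submission
  imports Defs
begin

text \<open>
  Put $g(s) = f(x + Qs)$, $S = R^{-1}$, $d = \max_i \|r_i\|$ and $H = \nabla^2 g(0)$. The Hessian of $g$ is
  again $L$-Lipschitz, and $\|S\| \le \|D^\dagger\|$ because $S = D^\dagger Q$.
  The simplex Hessian is $S^T B S$ with $B_{ij} = g(r_i + r_j) - g(r_i) - g(r_j) + g(0)$, and
  $|B_{ij} - r_i^T H r_j| \le L d^3$, so it differs from $H$ by at most $p \|S\|^2 L d^3$.
  In $2 \nabla_S g(0; R) - \nabla_S g(0; 2R)$ the second-order Taylor terms cancel, so it differs from
  $\nabla g(0)$ by at most $\sqrt p \, \|S\| L d^3$.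
  Adding these errors to those of the second-order Taylor polynomial of $g$ gives bounds that are
  polynomials in $z = \sqrt p \, M$. They are below the claimed constants since $z \ge 1$, which
  holds because $1 = \|S r_i\| \le \|S\| d \le M$.
\<close>

section \<open>Spectral norm\<close>

lemma inner_transpose_mult: "(transpose A *v w) \<bullet> u = w \<bullet> (A *v u)"
  for A :: "real^'n^'m"
  by (simp add: dot_lmul_matrix)

lemma norm_mult_le_spectral_norm: "norm (A *v v) \<le> spectral_norm A * norm v"
  unfolding spectral_norm_def by (rule onorm) simp

lemma spectral_norm_nonneg: "0 \<le> spectral_norm A"
  unfolding spectral_norm_def by (rule onorm_pos_le) simp

lemma spectral_norm_leI:
  assumes "0 \<le> b" "\<And>v. norm (A *v v) \<le> b * norm v"
  shows "spectral_norm A \<le> b"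
  unfolding spectral_norm_def using assms by (rule onorm_bound)

lemma spectral_norm_triangle: "spectral_norm (A + B) \<le> spectral_norm A + spectral_norm B"
  unfolding spectral_norm_def matrix_vector_mult_add_rdistrib by (intro onorm_triangle) simp_all

lemma spectral_norm_mult: "spectral_norm (A ** B) \<le> spectral_norm A * spectral_norm B"
proof (rule spectral_norm_leI)
  fix v
  have "norm (A *v (B *v v)) \<le> spectral_norm A * norm (B *v v)"
    by (rule norm_mult_le_spectral_norm)
  also have "\<dots> \<le> spectral_norm A * (spectral_norm B * norm v)"
    by (intro mult_left_mono norm_mult_le_spectral_norm spectral_norm_nonneg)
  finally show "norm ((A ** B) *v v) \<le> spectral_norm A * spectral_norm B * norm v"
    by (simp add: matrix_vector_mul_assoc mult.assoc)
qed (simp add: spectral_norm_nonneg)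

lemma spectral_norm_mult3:
  "spectral_norm (A ** B ** C) \<le> spectral_norm A * spectral_norm B * spectral_norm C"
  by (rule order_trans[OF spectral_norm_mult])
    (intro mult_right_mono spectral_norm_mult spectral_norm_nonneg)

text \<open>The square of \<open>norm ?w\<close> equals \<open>v \<bullet> (A *v ?w)\<close>;
  Cauchy-Schwarz bounds this by \<open>spectral_norm A * norm v * norm ?w\<close>, and one factor
  \<open>norm ?w\<close> cancels.\<close>

lemma spectral_norm_transpose_le: "spectral_norm (transpose A) \<le> spectral_norm A"
proof (rule spectral_norm_leI[OF spectral_norm_nonneg])
  fix v
  let ?w = "transpose A *v v"
  have "norm ?w * norm ?w = v \<bullet> (A *v ?w)"
    by (metis inner_transpose_mult norm_eq_sqrt_inner real_sqrt_mult_self abs_of_nonneg inner_ge_zero)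
  also have "\<dots> \<le> norm v * norm (A *v ?w)"
    by (rule norm_cauchy_schwarz)
  also have "\<dots> \<le> norm v * (spectral_norm A * norm ?w)"
    by (intro mult_left_mono norm_mult_le_spectral_norm) simp
  finally have "norm ?w * norm ?w \<le> (spectral_norm A * norm v) * norm ?w"
    by (simp add: mult_ac)
  then show "norm ?w \<le> spectral_norm A * norm v"
    by (cases "?w = 0") (auto simp: spectral_norm_nonneg simp del: transpose_matrix_vector)
qed

lemma spectral_norm_transpose: "spectral_norm (transpose A) = spectral_norm A"
  using spectral_norm_transpose_le[of A] spectral_norm_transpose_le[of "transpose A"] by simp

lemma norm_orthonormal_columns_mult:
  fixes Q :: "real^'n^'m"
  assumes "transpose Q ** Q = mat 1"
  shows "norm (Q *v v) = norm v"
proof -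
  have "transpose Q *v (Q *v v) = v"
    by (simp only: matrix_vector_mul_assoc assms matrix_vector_mul_lid)
  then have "(Q *v v) \<bullet> (Q *v v) = v \<bullet> v"
    by (metis inner_transpose_mult)
  then show ?thesis by (simp add: norm_eq_sqrt_inner)
qed

lemma spectral_norm_orthonormal_columns_le:
  assumes "transpose Q ** Q = mat 1"
  shows "spectral_norm Q \<le> 1"
  by (rule spectral_norm_leI) (simp_all add: norm_orthonormal_columns_mult[OF assms])

text \<open>Source of the \<open>sqrt p\<close> in the gradient error: it turns a bound on each
  entry of the defect into one on the whole vector.\<close>

lemma norm_le_sqrt_card:
  fixes v :: "real^'n"
  assumes "\<And>i. \<bar>v $ i\<bar> \<le> c"
  shows "norm v \<le> sqrt (real CARD('n)) * c"
proof -
  have "0 \<le> c" using assms[of undefined] by linarith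
  have "norm v \<le> L2_set (\<lambda>i::'n. c) UNIV"
    unfolding norm_vec_def using assms by (intro L2_set_mono) auto
  then show ?thesis using \<open>0 \<le> c\<close> by (simp add: L2_set_constant)
qed

text \<open>The entrywise estimate is used twice, for the rows of \<open>E\<close> and for the
  vector \<open>E *v v\<close>; each use costs the square root of the dimension.\<close>

lemma spectral_norm_le_card:
  fixes E :: "real^'n^'n"
  assumes "\<And>i j. \<bar>E $ i $ j\<bar> \<le> c"
  shows "spectral_norm E \<le> real CARD('n) * c"
proof (rule spectral_norm_leI)
  have "0 \<le> c" using assms[of undefined undefined] by linarith
  then show "0 \<le> real CARD('n) * c" by simp
  fix v
  have "\<bar>(E *v v) $ i\<bar> \<le> sqrt (real CARD('n)) * c * norm v" for i
  proof -
    have "\<bar>(E *v v) $ i\<bar> = \<bar>E $ i \<bullet> v\<bar>"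
      by (simp add: matrix_vector_mult_def inner_vec_def)
    also have "\<dots> \<le> norm (E $ i) * norm v" by (rule Cauchy_Schwarz_ineq2)
    also have "\<dots> \<le> sqrt (real CARD('n)) * c * norm v"
      by (intro mult_right_mono norm_le_sqrt_card assms) simp
    finally show ?thesis .
  qed
  from norm_le_sqrt_card[OF this]
  show "norm (E *v v) \<le> real CARD('n) * c * norm v"
    by (simp add: mult.assoc[symmetric])
qed

section \<open>Matrix products and pseudoinverses\<close>

lemma matrix_mult_diff_between:
  fixes B :: "real^'m^'n"
  shows "A ** (B - B') ** C = A ** B ** C - A ** B' ** C"
proof -
  have "A ** (B - B') = A ** B - A ** B'"
    by (simp add: matrix_matrix_mult_def vec_eq_iff right_diff_distrib sum_subtractf)
  then show ?thesis
    by (simp add: matrix_matrix_mult_def[of _ C] vec_eq_iff left_diff_distrib sum_subtractf)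
qed

lemma transpose_mult_mult_component:
  fixes A :: "real^'m^'n"
  shows "(transpose A ** B ** C) $ i $ j = column i A \<bullet> (B *v column j C)"
  unfolding matrix_mul_assoc[symmetric]
  by (simp add: matrix_matrix_mult_def matrix_vector_mult_def inner_vec_def column_def transpose_def)

text \<open>Uniqueness of the Moore-Penrose inverse. Transposing
  \<open>(A ** Y) ** (A ** X) = A ** X\<close> swaps the symmetric factors, and the swapped product
  collapses to \<open>A ** Y\<close>; so \<open>A ** Y = A ** X\<close>, and similarly
  \<open>Y ** A = X ** A\<close>.\<close>

lemma pseudoinverse_eqI:
  fixes A :: "real^'n^'m"
  assumes "A ** X ** A = A" "X ** A ** X = X"
    "transpose (A ** X) = A ** X" "transpose (X ** A) = X ** A"
  shows "pseudoinverse A = X"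
  unfolding pseudoinverse_def
proof (rule the_equality)
  fix Y
  assume Y: "A ** Y ** A = A \<and> Y ** A ** Y = Y \<and>
     transpose (A ** Y) = A ** Y \<and> transpose (Y ** A) = Y ** A"
  then have Y: "A ** Y ** A = A" "Y ** A ** Y = Y"
    "transpose (A ** Y) = A ** Y" "transpose (Y ** A) = Y ** A" by blast+
  have "(A ** Y) ** (A ** X) = A ** X"
    unfolding matrix_mul_assoc Y(1) ..
  then have "transpose (A ** X) ** transpose (A ** Y) = transpose (A ** X)"
    by (simp only: matrix_transpose_mul[symmetric])
  then have "A ** X ** (A ** Y) = A ** X"
    unfolding Y(3) assms(3) .
  then have AX: "A ** Y = A ** X"
    unfolding matrix_mul_assoc assms(1) .
  have "(X ** A) ** (Y ** A) = X ** A"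
    by (simp only: matrix_mul_assoc[symmetric, of X] matrix_mul_assoc[of A] Y(1))
  then have "transpose (Y ** A) ** transpose (X ** A) = transpose (X ** A)"
    by (simp only: matrix_transpose_mul[symmetric])
  then have "(Y ** A) ** (X ** A) = X ** A"
    unfolding Y(4) assms(4) .
  then have XA: "Y ** A = X ** A"
    by (simp only: matrix_mul_assoc[symmetric, of Y] matrix_mul_assoc[of A] assms(1))
  have "Y = X ** A ** Y"
    using Y(2) by (simp only: XA)
  also have "\<dots> = X"
    using assms(2) by (simp only: matrix_mul_assoc[symmetric] AX)
  finally show "Y = X" .
qed (use assms in blast)

text \<open>Covers both the inverse of a square matrix and a tall matrix of full column rank, where
  \<open>A ** X\<close> is an orthogonal projection.\<close>

lemma pseudoinverse_left_inverse:
  fixes A :: "real^'n^'m"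
  assumes "X ** A = mat 1" "transpose (A ** X) = A ** X"
  shows "pseudoinverse A = X"
  using assms by (intro pseudoinverse_eqI)
    (simp_all add: matrix_mul_assoc[symmetric] transpose_mat)

section \<open>Gradients and Hessians\<close>

lemma gradient_eqI:
  assumes "(f has_derivative (\<lambda>h. D \<bullet> h)) (at x)"
  shows "gradient f x = D"
  unfolding gradient_def
proof (rule the_equality)
  show D: "GDERIV f x :> D"
    using assms by (simp add: gderiv_def inner_commute)
  fix D' assume "GDERIV f x :> D'"
  then have "(\<lambda>h. h \<bullet> D') = (\<lambda>h. h \<bullet> D)"
    using D unfolding gderiv_def by (rule has_derivative_unique)
  then show "D' = D"
    using vector_eq_rdot[of D' D] by (simp add: inner_commute fun_eq_iff)
qed

text \<open>Riesz representation: the functional \<open>f'\<close> is the inner product with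
  \<open>adjoint f' 1\<close>, which is the witness for the description in
  \<open>gradient\<close>.\<close>

lemma has_derivative_gradient:
  fixes f :: "'a::euclidean_space \<Rightarrow> real"
  assumes "f differentiable at x"
  shows "(f has_derivative (\<lambda>h. gradient f x \<bullet> h)) (at x)"
proof -
  obtain f' where f': "(f has_derivative f') (at x)"
    using assms by (auto simp: differentiable_def)
  interpret linear f' by (rule has_derivative_linear[OF f'])
  have "f' h = adjoint f' 1 \<bullet> h" for h
    using adjoint_works[OF linear_axioms, of h 1] by (subst inner_commute) simp
  then have "f' = (\<lambda>h. adjoint f' 1 \<bullet> h)" by (rule ext)
  with f' have "(f has_derivative (\<lambda>h. adjoint f' 1 \<bullet> h)) (at x)" by (rule subst[rotated])
  then show ?thesis by (simp only: gradient_eqI)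
qed

text \<open>\<open>hessian\<close> differentiates the function \<open>gradient f\<close>, so the
  first assumption identifies \<open>G\<close> with it at every point.\<close>

lemma hessian_eqI:
  assumes "\<And>y. (f has_derivative (\<lambda>h. G y \<bullet> h)) (at y)"
    and "(G has_derivative (\<lambda>h. H *v h)) (at x)"
  shows "hessian f x = H"
proof -
  have "gradient f = G"
    using assms(1) by (auto intro: gradient_eqI)
  then show ?thesis
    by (simp add: hessian_def jacobian_def frechet_derivative_at[OF assms(2), symmetric])
qed

lemma has_derivative_hessian:
  assumes "gradient f differentiable at x"
  shows "(gradient f has_derivative (\<lambda>h. hessian f x *v h)) (at x)"
  using assms unfolding hessian_def by (simp add: jacobian_works)

text \<open>Symmetry merges the two terms of the product rule, so the factor 1/2 cancels and the
  Hessian is \<open>A\<close> itself rather than its symmetric part.\<close>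

lemma quadratic_derivatives:
  fixes A :: "real^'n^'n" and b :: "real^'n" and a :: real
  assumes "transpose A = A"
  defines "m \<equiv> \<lambda>s. a + b \<bullet> s + 1 / 2 * (s \<bullet> (A *v s))"
  shows quadratic_gradient: "gradient m s = b + A *v s"
    and quadratic_hessian: "hessian m s = A"
    and C2_quadratic: "C2 m"
proof -
  have A: "((\<lambda>s. A *v s) has_derivative (\<lambda>h. A *v h)) (at y within S)" for y S
    by (rule bounded_linear_imp_has_derivative) simp
  have sym: "y \<bullet> (A *v h) = (A *v y) \<bullet> h" for y h
    using inner_transpose_mult[of A y h] assms(1) by (simp del: transpose_matrix_vector)
  have m: "(m has_derivative (\<lambda>h. (b + A *v y) \<bullet> h)) (at y)" for y
  proof -
    have "(m has_derivative (\<lambda>h. 0 + b \<bullet> h + 1 / 2 * (y \<bullet> (A *v h) + h \<bullet> (A *v y)))) (at y)"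
      unfolding m_def
      by (intro has_derivative_add has_derivative_const has_derivative_mult_right
          has_derivative_inner_right has_derivative_inner has_derivative_ident A)
    then show ?thesis
      by (simp only: sym[of y] inner_commute[of _ "A *v y"]) (simp add: inner_add_left)
  qed
  have G: "((\<lambda>s. b + A *v s) has_derivative (\<lambda>h. A *v h)) (at y)" for y
    using has_derivative_add[OF has_derivative_const[of b] A] by simp
  have grad: "gradient m = (\<lambda>s. b + A *v s)"
    using gradient_eqI[OF m] by auto
  have hess: "hessian m = (\<lambda>s. A)"
    using hessian_eqI[OF m G] by auto
  show "gradient m s = b + A *v s" "hessian m s = A" "C2 m"
    unfolding C2_def grad hess using m G by (auto simp: differentiable_def)
qed

text \<open>Mean value inequality with a scalar majorant. It replaces integration in the Taylor
  estimates, with \<open>\<phi>\<close> an antiderivative of the bound on \<open>k'\<close>.\<close>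

lemma norm_increment_le:
  fixes k :: "real \<Rightarrow> 'a::real_normed_vector"
  assumes "\<And>t. (k has_vector_derivative k' t) (at t)"
    and "\<And>t. (\<phi> has_real_derivative \<phi>' t) (at t)"
    and "\<And>t. 0 < t \<Longrightarrow> t < 1 \<Longrightarrow> norm (k' t) \<le> \<phi>' t"
  shows "norm (k 1 - k 0) \<le> \<phi> 1 - \<phi> 0"
  using assms
  by (intro differentiable_bound_general[where f'=k' and \<phi>'=\<phi>'])
    (auto simp: has_real_derivative_iff_has_vector_derivative
      intro!: continuous_at_imp_continuous_on has_vector_derivative_continuous)

section \<open>Simplex derivatives for an invertible matrix\<close>

lemma pseudoinverse_transpose_inverse:
  fixes R S :: "real^'p^'p"
  assumes "R ** S = mat 1" "S ** R = mat 1"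
  shows "pseudoinverse (transpose R) = transpose S"
  using assms
  by (intro pseudoinverse_left_inverse) (simp_all add: matrix_transpose_mul[symmetric] transpose_mat)

lemma pseudoinverse_transpose_inverse_double:
  fixes R S :: "real^'p^'p"
  assumes "R ** S = mat 1" "S ** R = mat 1"
  shows "pseudoinverse (transpose (2 *\<^sub>R R)) = (1 / 2) *\<^sub>R transpose S"
proof -
  have "(2 *\<^sub>R R) ** ((1 / 2) *\<^sub>R S) = mat 1" "((1 / 2) *\<^sub>R S) ** (2 *\<^sub>R R) = mat 1"
    using assms by (simp_all add: scalar_matrix_assoc[symmetric] matrix_scalar_ac)
  then show ?thesis
    using pseudoinverse_transpose_inverse transpose_scalar by metis
qed

text \<open>Approximates \<open>transpose R ** H ** R\<close>, where \<open>H\<close> is the Hessian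
  of \<open>g\<close> at the origin.\<close>

definition second_differences :: "(real^'p \<Rightarrow> real) \<Rightarrow> real^'z^'p \<Rightarrow> real^'z^'z" where
  "second_differences g R =
     (\<chi> i j. g (column i R + column j R) - g (column i R) - g (column j R) + g 0)"

text \<open>The inverse transpose acts twice: inside each simplex gradient, where on rows it becomes
  \<open>S\<close> on the right, and once more outside on the left.\<close>

lemma simplex_hessian_inverse:
  fixes R S :: "real^'p^'p"
  assumes "R ** S = mat 1" "S ** R = mat 1"
  shows "simplex_hessian g 0 R = transpose S ** second_differences g R ** S"
proof -
  have "delta_simplex_gradient g 0 R $ i = (second_differences g R ** S) $ i" for i
  proof -
    have "delta_simplex_gradient g 0 R $ i
        = transpose S *v (delta g (column i R) R - delta g 0 R)"
      by (simp add: delta_simplex_gradient_def simplex_gradient_def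
          pseudoinverse_transpose_inverse[OF assms] matrix_vector_mult_diff_distrib
          del: transpose_matrix_vector)
    also have "delta g (column i R) R - delta g 0 R = second_differences g R $ i"
      by (simp add: delta_def second_differences_def vec_eq_iff)
    also have "transpose S *v (second_differences g R $ i) = (second_differences g R ** S) $ i"
      by (simp add: matrix_vector_mult_def matrix_matrix_mult_def transpose_def vec_eq_iff mult.commute
          del: transpose_matrix_vector)
    finally show ?thesis .
  qed
  then have "delta_simplex_gradient g 0 R = second_differences g R ** S"
    by (simp add: vec_eq_iff)
  then show ?thesis
    by (simp add: simplex_hessian_def pseudoinverse_transpose_inverse[OF assms] matrix_mul_assoc)
qed

text \<open>Congruence by \<open>S\<close> preserves the symmetry of the second differences.
  \<open>quadratic_derivatives\<close> requires this of the model.\<close>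

lemma transpose_simplex_hessian:
  fixes R S :: "real^'p^'p"
  assumes "R ** S = mat 1" "S ** R = mat 1"
  shows "transpose (simplex_hessian g 0 R) = simplex_hessian g 0 R"
proof -
  have "transpose (second_differences g R) = second_differences g R"
    by (simp add: second_differences_def transpose_def vec_eq_iff add.commute algebra_simps)
  then show ?thesis
    by (simp add: simplex_hessian_inverse[OF assms] matrix_transpose_mul matrix_mul_assoc)
qed

section \<open>Error bounds\<close>

text \<open>\<open>G\<close> and \<open>H\<close> are explicit parameters because the chain rule
  supplies them directly for the restriction of \<open>f\<close> to the subspace.\<close>

locale lipschitz_hessian =
  fixes g :: "real^'p \<Rightarrow> real" and G :: "real^'p \<Rightarrow> real^'p" and H :: "real^'p \<Rightarrow> real^'p^'p"
    and L :: real
  assumes gradient: "\<And>s. (g has_derivative (\<lambda>h. G s \<bullet> h)) (at s)"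
    and hessian: "\<And>s. (G has_derivative (\<lambda>h. H s *v h)) (at s)"
    and L_nonneg: "0 \<le> L"
    and lipschitz: "\<And>s t. spectral_norm (H s - H t) \<le> L * norm (s - t)"
begin

lemma has_derivative_line:
  shows "((\<lambda>t. g (w + t *\<^sub>R u)) has_real_derivative G (w + t *\<^sub>R u) \<bullet> u) (at t)"
    and "((\<lambda>t. G (w + t *\<^sub>R u)) has_vector_derivative H (w + t *\<^sub>R u) *v u) (at t)"
proof -
  have l: "((\<lambda>t. w + t *\<^sub>R u) has_derivative (\<lambda>h. h *\<^sub>R u)) (at t)"
    by (auto intro!: derivative_eq_intros)
  show "((\<lambda>t. g (w + t *\<^sub>R u)) has_real_derivative G (w + t *\<^sub>R u) \<bullet> u) (at t)"
    using has_derivative_compose[OF l gradient]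
    by (simp add: has_field_derivative_def mult_commute_abs)
  show "((\<lambda>t. G (w + t *\<^sub>R u)) has_vector_derivative H (w + t *\<^sub>R u) *v u) (at t)"
    using has_derivative_compose[OF l hessian]
    by (simp add: has_vector_derivative_def scaleR_matrix_vector_assoc matrix_vector_mult_scaleR)
qed

text \<open>On the segment from \<open>w\<close> to \<open>w + u\<close> the Hessian is within
  \<open>L * (norm w + t * norm u)\<close> of \<open>H 0\<close>; integrating over \<open>t\<close>
  yields the 1/2. The reference is \<open>H 0\<close>, not \<open>H w\<close>, so that one matrix
  serves all base points in \<open>second_difference\<close>.\<close>

lemma gradient_increment:
  "norm (G (w + u) - G w - H 0 *v u) \<le> L * (norm w + norm u / 2) * norm u"
proof -
  let ?k = "\<lambda>t. G (w + t *\<^sub>R u) - t *\<^sub>R (H 0 *v u)"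
  have "norm (?k 1 - ?k 0) \<le> (\<lambda>t. L * (norm w * t + norm u * t\<^sup>2 / 2) * norm u) 1
      - (\<lambda>t. L * (norm w * t + norm u * t\<^sup>2 / 2) * norm u) 0"
  proof (rule norm_increment_le)
    fix t :: real
    show "(?k has_vector_derivative (H (w + t *\<^sub>R u) - H 0) *v u) (at t)"
    proof -
      have "((\<lambda>t. t *\<^sub>R (H 0 *v u)) has_vector_derivative H 0 *v u) (at t)"
        by (simp add: has_vector_derivative_def bounded_linear_imp_has_derivative
            bounded_linear_scaleR_left)
      from has_vector_derivative_diff[OF has_derivative_line(2) this] show ?thesis
        by (simp add: matrix_vector_mult_diff_rdistrib)
    qed
    show "((\<lambda>t. L * (norm w * t + norm u * t\<^sup>2 / 2) * norm u)
        has_real_derivative L * (norm w + t * norm u) * norm u) (at t)"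
      by (auto intro!: derivative_eq_intros)
    assume t: "0 < t"
    have "norm ((H (w + t *\<^sub>R u) - H 0) *v u) \<le> L * norm (w + t *\<^sub>R u) * norm u"
      using lipschitz[of "w + t *\<^sub>R u" 0]
      by (intro order_trans[OF norm_mult_le_spectral_norm mult_right_mono]) simp_all
    also have "\<dots> \<le> L * (norm w + t * norm u) * norm u"
      using t norm_triangle_ineq[of w "t *\<^sub>R u"]
      by (intro mult_right_mono mult_left_mono L_nonneg) auto
    finally show "norm ((H (w + t *\<^sub>R u) - H 0) *v u) \<le> L * (norm w + t * norm u) * norm u" .
  qed
  then show ?thesis by (simp add: algebra_simps)
qed

lemma gradient_taylor: "norm (G u - G 0 - H 0 *v u) \<le> L / 2 * (norm u)\<^sup>2"
  using gradient_increment[of 0 u] by (simp add: power2_eq_square)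

lemma taylor: "\<bar>g s - g 0 - G 0 \<bullet> s - 1 / 2 * (s \<bullet> (H 0 *v s))\<bar> \<le> L / 6 * norm s ^ 3"
proof -
  define q where "q = s \<bullet> (H 0 *v s)"
  \<comment> \<open>The summand 0 lets \<open>has_derivative_line\<close> apply with base point
    \<open>w = 0\<close>.\<close>
  let ?k = "\<lambda>t. g (0 + t *\<^sub>R s) - t * (G 0 \<bullet> s) - t\<^sup>2 / 2 * q"
  let ?k' = "\<lambda>t. (G (t *\<^sub>R s) - G 0 - H 0 *v (t *\<^sub>R s)) \<bullet> s"
  have "norm (?k 1 - ?k 0) \<le> (\<lambda>t. L / 6 * norm s ^ 3 * t ^ 3) 1 - (\<lambda>t. L / 6 * norm s ^ 3 * t ^ 3) 0"
  proof (rule norm_increment_le)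
    fix t :: real
    have "(?k has_real_derivative ?k' t) (at t)"
    proof -
      have "((\<lambda>t. t * (G 0 \<bullet> s)) has_real_derivative G 0 \<bullet> s) (at t)"
        "((\<lambda>t. t\<^sup>2 / 2 * q) has_real_derivative t * q) (at t)"
        by (auto intro!: derivative_eq_intros)
      from DERIV_diff[OF DERIV_diff[OF has_derivative_line(1)[of 0 s t] this(1)] this(2)] show ?thesis
        by (simp add: q_def inner_diff_left inner_diff_right matrix_vector_mult_scaleR inner_commute)
    qed
    then show "(?k has_vector_derivative ?k' t) (at t)"
      by (simp add: has_real_derivative_iff_has_vector_derivative)
    show "((\<lambda>t. L / 6 * norm s ^ 3 * t ^ 3) has_real_derivative L / 2 * norm s ^ 3 * t\<^sup>2) (at t)"
      by (auto intro!: derivative_eq_intros)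
    assume t: "0 < t"
    have "norm (?k' t) \<le> norm (G (t *\<^sub>R s) - G 0 - H 0 *v (t *\<^sub>R s)) * norm s"
      by (simp add: Cauchy_Schwarz_ineq2)
    also have "\<dots> \<le> L / 2 * (norm (t *\<^sub>R s))\<^sup>2 * norm s"
      by (intro mult_right_mono gradient_taylor) simp
    finally show "norm (?k' t) \<le> L / 2 * norm s ^ 3 * t\<^sup>2"
      by (simp add: power_mult_distrib power2_eq_square power3_eq_cube mult_ac)
  qed
  then show ?thesis by (simp add: q_def algebra_simps)
qed

text \<open>Along \<open>v\<close>, the difference of \<open>g\<close> at \<open>u + t v\<close> and
  at \<open>t v\<close> has as derivative a gradient increment by \<open>u\<close> from
  \<open>t v\<close>, which \<open>gradient_increment\<close> controls; a second integration gives
  the bound.\<close>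

lemma second_difference:
  "\<bar>g (u + v) - g u - g v + g 0 - v \<bullet> (H 0 *v u)\<bar> \<le> L * (norm u + norm v) / 2 * norm u * norm v"
proof -
  let ?k = "\<lambda>t. g (u + t *\<^sub>R v) - g (0 + t *\<^sub>R v) - t * (v \<bullet> (H 0 *v u))"
  let ?k' = "\<lambda>t. (G (t *\<^sub>R v + u) - G (t *\<^sub>R v) - H 0 *v u) \<bullet> v"
  let ?\<phi> = "\<lambda>t. L * (norm v * t\<^sup>2 / 2 + norm u / 2 * t) * norm u * norm v"
  have "norm (?k 1 - ?k 0) \<le> ?\<phi> 1 - ?\<phi> 0"
  proof (rule norm_increment_le)
    fix t :: real
    have "(?k has_real_derivative ?k' t) (at t)"
      by (rule derivative_eq_intros has_derivative_line refl)+
        (simp add: inner_simps inner_commute add.commute)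
    then show "(?k has_vector_derivative ?k' t) (at t)"
      by (simp add: has_real_derivative_iff_has_vector_derivative)
    show "(?\<phi> has_real_derivative L * (t * norm v + norm u / 2) * norm u * norm v) (at t)"
      by (auto intro!: derivative_eq_intros)
    assume t: "0 < t"
    have "norm (?k' t) \<le> norm (G (t *\<^sub>R v + u) - G (t *\<^sub>R v) - H 0 *v u) * norm v"
      by (simp add: Cauchy_Schwarz_ineq2)
    also have "\<dots> \<le> L * (norm (t *\<^sub>R v) + norm u / 2) * norm u * norm v"
      by (intro mult_right_mono gradient_increment) simp
    finally show "norm (?k' t) \<le> L * (t * norm v + norm u / 2) * norm u * norm v"
      using t by simp
  qed
  then show ?thesis by (simp add: algebra_simps)
qed

text \<open>A Richardson extrapolation. The gradient error is \<open>transpose S\<close> applied to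
  the defect \<open>?b\<close>, so a third-order bound on each entry of \<open>?b\<close>
  suffices.\<close>

lemma simplex_gradient_error:
  fixes R S :: "real^'p^'p"
  assumes "R ** S = mat 1" "S ** R = mat 1" and d: "\<And>i. norm (column i R) \<le> d"
  shows "norm (2 *\<^sub>R simplex_gradient g 0 R - simplex_gradient g 0 (2 *\<^sub>R R) - G 0)
    \<le> spectral_norm S * (sqrt (real CARD('p)) * (L * d ^ 3))"
proof -
  let ?b = "2 *\<^sub>R delta g 0 R - (1 / 2) *\<^sub>R delta g 0 (2 *\<^sub>R R) - transpose R *v G 0"
  have G0: "G 0 = transpose S *v (transpose R *v G 0)"
    by (simp only: matrix_vector_mul_assoc matrix_transpose_mul[symmetric] assms transpose_mat
        matrix_vector_mul_lid)
  have "transpose S *v ?b = 2 *\<^sub>R simplex_gradient g 0 R - simplex_gradient g 0 (2 *\<^sub>R R) - G 0"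
    unfolding simplex_gradient_def pseudoinverse_transpose_inverse[OF assms(1,2)]
      pseudoinverse_transpose_inverse_double[OF assms(1,2)] matrix_vector_mult_diff_distrib G0[symmetric]
    by (simp only: matrix_vector_mult_scaleR scaleR_matrix_vector_assoc[symmetric])
  then have "2 *\<^sub>R simplex_gradient g 0 R - simplex_gradient g 0 (2 *\<^sub>R R) - G 0 = transpose S *v ?b" ..
  also have "norm \<dots> \<le> spectral_norm S * norm ?b"
    using norm_mult_le_spectral_norm[of "transpose S"] by (simp only: spectral_norm_transpose)
  also have "\<dots> \<le> spectral_norm S * (sqrt (real CARD('p)) * (L * d ^ 3))"
  proof (intro mult_left_mono norm_le_sqrt_card spectral_norm_nonneg)
    fix i
    let ?r = "column i R"
    have c: "(transpose R *v G 0) $ i = G 0 \<bullet> ?r" "column i (2 *\<^sub>R R) = 2 *\<^sub>R ?r"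
      by (simp_all add: matrix_vector_mult_def transpose_def inner_vec_def column_def vec_eq_iff mult.commute
          del: transpose_matrix_vector)
    have b: "?b $ i = 2 * (g ?r - g 0) - 1 / 2 * (g (2 *\<^sub>R ?r) - g 0) - G 0 \<bullet> ?r"
      by (simp add: delta_def c del: transpose_matrix_vector)
    have t1: "\<bar>g ?r - g 0 - G 0 \<bullet> ?r - 1 / 2 * (?r \<bullet> (H 0 *v ?r))\<bar> \<le> L * norm ?r ^ 3 / 6"
      using taylor[of ?r] by simp
    have t2: "\<bar>g (2 *\<^sub>R ?r) - g 0 - 2 * (G 0 \<bullet> ?r) - 2 * (?r \<bullet> (H 0 *v ?r))\<bar> \<le> 8 * (L * norm ?r ^ 3 / 6)"
      using taylor[of "2 *\<^sub>R ?r"] by (simp add: matrix_vector_mult_scaleR power_mult_distrib)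
    \<comment> \<open>The quadratic terms cancel, as \<open>2 * 1/2 - 1/2 * 2 = 0\<close>; the
      remainders add up with weight \<open>2 * 1/6 + 1/2 * 8/6 = 1\<close>.\<close>
    have "\<bar>?b $ i\<bar> \<le> L * norm ?r ^ 3"
      using abs_le_D1[OF t1] abs_le_D2[OF t1] abs_le_D1[OF t2] abs_le_D2[OF t2] unfolding b
      by (intro abs_leI) argo+
    also have "\<dots> \<le> L * d ^ 3"
      by (intro mult_left_mono power_mono d L_nonneg) simp
    finally show "\<bar>?b $ i\<bar> \<le> L * d ^ 3" .
  qed
  finally show ?thesis .
qed

lemma simplex_hessian_error:
  fixes R S :: "real^'p^'p"
  assumes "R ** S = mat 1" "S ** R = mat 1" and d: "\<And>i. norm (column i R) \<le> d"
  shows "spectral_norm (simplex_hessian g 0 R - H 0)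
    \<le> (spectral_norm S)\<^sup>2 * (real CARD('p) * (L * d ^ 3))"
proof -
  let ?E = "second_differences g R - transpose R ** H 0 ** R"
  \<comment> \<open>Written this way, \<open>H 0\<close> is a congruence by \<open>S\<close> like
    the simplex Hessian, so their difference is the congruence of the entrywise error
    \<open>?E\<close>.\<close>
  have "H 0 = (transpose S ** transpose R) ** H 0 ** (R ** S)"
    by (simp add: matrix_transpose_mul[symmetric] assms transpose_mat)
  then have "simplex_hessian g 0 R - H 0 = transpose S ** ?E ** S"
    by (simp add: simplex_hessian_inverse[OF assms(1,2)] matrix_mul_assoc
        matrix_mult_diff_between)
  also have "spectral_norm \<dots> \<le> spectral_norm S * spectral_norm ?E * spectral_norm S"
    using spectral_norm_mult3[of "transpose S" ?E S] by (simp only: spectral_norm_transpose)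
  also have "spectral_norm ?E \<le> real CARD('p) * (L * d ^ 3)"
  proof (rule spectral_norm_le_card)
    fix i j
    let ?u = "column i R" and ?v = "column j R"
    \<comment> \<open>The roles of \<open>i\<close> and \<open>j\<close> are exchanged, so that the symmetry of \<open>H 0\<close> is not needed.\<close>
    have "\<bar>?E $ i $ j\<bar> = \<bar>g (?v + ?u) - g ?v - g ?u + g 0 - ?u \<bullet> (H 0 *v ?v)\<bar>"
      by (simp add: second_differences_def transpose_mult_mult_component add.commute)
    also have "\<dots> \<le> L * (norm ?v + norm ?u) / 2 * norm ?v * norm ?u"
      by (rule second_difference)
    also have "\<dots> \<le> L * (d + d) / 2 * d * d"
      using L_nonneg d order_trans[OF norm_ge_zero d]
      by (intro mult_mono divide_right_mono add_mono mult_nonneg_nonneg divide_nonneg_nonneg) auto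
    finally show "\<bar>?E $ i $ j\<bar> \<le> L * d ^ 3"
      by (simp add: power3_eq_cube mult.assoc)
  qed
  finally show ?thesis
    by (simp add: power2_eq_square mult_right_mono mult_left_mono spectral_norm_nonneg mult_ac)
qed

text \<open>The error splits into the Taylor remainder of \<open>g\<close> and the perturbations
  \<open>c - G 0\<close> and \<open>A - H 0\<close> of the Taylor coefficients.\<close>

lemma quadratic_model_error:
  fixes A :: "real^'p^'p" and c :: "real^'p"
  assumes c: "norm (c - G 0) \<le> a" and A: "spectral_norm (A - H 0) \<le> b"
  shows "\<bar>g s - (g 0 + c \<bullet> s + 1 / 2 * (s \<bullet> (A *v s)))\<bar>
      \<le> L / 6 * norm s ^ 3 + a * norm s + b / 2 * (norm s)\<^sup>2" (is ?value)
    and "norm (G s - (c + A *v s)) \<le> L / 2 * (norm s)\<^sup>2 + a + b * norm s" (is ?gradient)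
    and "spectral_norm (H s - A) \<le> L * norm s + b" (is ?hessian)
proof -
  have As: "norm ((A - H 0) *v s) \<le> b * norm s"
    using norm_mult_le_spectral_norm[of "A - H 0" s] A
    by (meson mult_right_mono norm_ge_zero order_trans)
  have 1: "\<bar>(c - G 0) \<bullet> s\<bar> \<le> a * norm s"
    using Cauchy_Schwarz_ineq2[of "c - G 0" s] c by (meson mult_right_mono norm_ge_zero order_trans)
  have 2: "\<bar>s \<bullet> ((A - H 0) *v s)\<bar> \<le> b * (norm s)\<^sup>2"
    using Cauchy_Schwarz_ineq2[of s "(A - H 0) *v s"] mult_left_mono[OF As norm_ge_zero[of s]]
    by (simp add: power2_eq_square mult_ac)
  show ?value
  proof -
    have "g s - (g 0 + c \<bullet> s + 1 / 2 * (s \<bullet> (A *v s)))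
        = (g s - g 0 - G 0 \<bullet> s - 1 / 2 * (s \<bullet> (H 0 *v s))) - (c - G 0) \<bullet> s
          - 1 / 2 * (s \<bullet> ((A - H 0) *v s))"
      by (simp add: inner_diff_left inner_diff_right matrix_vector_mult_diff_rdistrib field_simps)
    then show ?thesis
      using taylor[of s] 1 2 by linarith
  qed
  have "G s - (c + A *v s) = (G s - G 0 - H 0 *v s) - (c - G 0) - (A - H 0) *v s"
    by (simp add: matrix_vector_mult_diff_rdistrib)
  with gradient_taylor[of s] c As norm_triangle_ineq4[of "G s - G 0 - H 0 *v s" "c - G 0"]
      norm_triangle_ineq4[of "(G s - G 0 - H 0 *v s) - (c - G 0)" "(A - H 0) *v s"]
  show ?gradient
    by (simp only:)
  have "spectral_norm (H 0 - A) = spectral_norm (A - H 0)"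
  proof -
    have "(*v) (H 0 - A) = (\<lambda>v. - ((A - H 0) *v v))"
      by (simp add: fun_eq_iff matrix_vector_mult_diff_rdistrib)
    then show ?thesis
      unfolding spectral_norm_def by (simp only: onorm_neg)
  qed
  then show ?hessian
    using spectral_norm_triangle[of "H s - H 0" "H 0 - A"] lipschitz[of s 0] A by simp
qed

end

section \<open>Restriction to the subspace and inversion of the triangular factor\<close>

text \<open>The derivatives come from the chain rule. \<open>Q\<close> preserves norms and has
  spectral norm at most 1, so the constant \<open>L\<close> is kept.\<close>

lemma lipschitz_hessian_compose:
  fixes f :: "real^'n \<Rightarrow> real" and Q :: "real^'p^'n"
  assumes f: "C2_plus f L" and Q: "transpose Q ** Q = mat 1"
  shows "lipschitz_hessian (\<lambda>s. f (x + Q *v s)) (\<lambda>s. transpose Q *v gradient f (x + Q *v s))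
    (\<lambda>s. transpose Q ** hessian f (x + Q *v s) ** Q) L"
proof
  have inner: "((\<lambda>s. x + Q *v s) has_derivative (\<lambda>h. Q *v h)) (at s)" for s
    by (auto intro!: derivative_eq_intros bounded_linear_imp_has_derivative)
  fix s t
  have "f differentiable at (x + Q *v s)" and "gradient f differentiable at (x + Q *v s)"
    using f by (auto simp: C2_plus_def C2_def)
  from has_derivative_compose[OF inner has_derivative_gradient[OF this(1)]]
    has_derivative_compose[OF inner has_derivative_hessian[OF this(2)]]
  show "((\<lambda>s. f (x + Q *v s)) has_derivative
      (\<lambda>h. (transpose Q *v gradient f (x + Q *v s)) \<bullet> h)) (at s)"
    and "((\<lambda>s. transpose Q *v gradient f (x + Q *v s)) has_derivative
      (\<lambda>h. (transpose Q ** hessian f (x + Q *v s) ** Q) *v h)) (at s)"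
    by (simp_all only: inner_transpose_mult matrix_vector_mul_assoc[symmetric]
        bounded_linear.has_derivative[OF matrix_vector_mul_bounded_linear])
  show "0 \<le> L"
    using f by (simp add: C2_plus_def)
  let ?E = "hessian f (x + Q *v s) - hessian f (x + Q *v t)"
  have "transpose Q ** hessian f (x + Q *v s) ** Q - transpose Q ** hessian f (x + Q *v t) ** Q
      = transpose Q ** ?E ** Q"
    by (simp add: matrix_mult_diff_between)
  also have "spectral_norm \<dots> \<le> spectral_norm (transpose Q) * spectral_norm ?E * spectral_norm Q"
    by (rule spectral_norm_mult3)
  also have "\<dots> \<le> 1 * spectral_norm ?E * 1"
    using spectral_norm_orthonormal_columns_le[OF Q]
    by (intro mult_mono) (simp_all add: spectral_norm_transpose spectral_norm_nonneg)
  also have "\<dots> = spectral_norm ?E"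
    by simp
  also have "\<dots> \<le> L * norm ((x + Q *v s) - (x + Q *v t))"
    using f unfolding C2_plus_def by blast
  also have "(x + Q *v s) - (x + Q *v t) = Q *v (s - t)"
    by (simp add: matrix_vector_mult_diff_distrib)
  finally show "spectral_norm (transpose Q ** hessian f (x + Q *v s) ** Q
      - transpose Q ** hessian f (x + Q *v t) ** Q) \<le> L * norm (s - t)"
    by (simp only: norm_orthonormal_columns_mult[OF Q])
qed

text \<open>Injectivity passes from \<open>D\<close> to the square matrix \<open>R\<close>. Since
  \<open>S ** transpose Q\<close> is a left inverse of \<open>D\<close> and
  \<open>D ** (S ** transpose Q)\<close> is the symmetric matrix \<open>Q ** transpose Q\<close>, it
  is the pseudoinverse; multiplying by \<open>Q\<close> recovers \<open>S\<close>.\<close>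

lemma is_QR_factorization_inverse:
  fixes D Q :: "real^('p::{finite,linorder})^'n"
  assumes "is_QR_factorization D Q R" "rank D = CARD('p)"
  obtains S where "R ** S = mat 1" "S ** R = mat 1" "spectral_norm S \<le> spectral_norm (pseudoinverse D)"
proof -
  have D: "D = Q ** R" and Q: "transpose Q ** Q = mat 1"
    using assms(1) by (simp_all add: is_QR_factorization_def)
  have "inj ((*v) D)"
    using assms(2) by (simp add: full_rank_injective)
  then have "inj ((*v) R)"
    unfolding D by (metis inj_def matrix_vector_mul_assoc)
  then obtain S where SR: "S ** R = mat 1"
    using matrix_left_invertible_injective by blast
  then have RS: "R ** S = mat 1"
    by (simp add: matrix_left_right_inverse)
  have "(S ** transpose Q) ** D = S ** (transpose Q ** Q) ** R"
    unfolding D by (simp only: matrix_mul_assoc)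
  then have "(S ** transpose Q) ** D = mat 1"
    by (simp add: Q SR)
  moreover have "D ** (S ** transpose Q) = Q ** (R ** S) ** transpose Q"
    unfolding D by (simp only: matrix_mul_assoc)
  then have "D ** (S ** transpose Q) = Q ** transpose Q"
    by (simp add: RS)
  ultimately have "pseudoinverse D = S ** transpose Q"
    by (intro pseudoinverse_left_inverse) (simp_all add: matrix_transpose_mul)
  then have "S = pseudoinverse D ** Q"
    by (metis Q matrix_mul_assoc matrix_mul_rid)
  then have "spectral_norm S \<le> spectral_norm (pseudoinverse D) * spectral_norm Q"
    by (metis spectral_norm_mult)
  also have "\<dots> \<le> spectral_norm (pseudoinverse D) * 1"
    by (intro mult_left_mono spectral_norm_orthonormal_columns_le Q spectral_norm_nonneg)
  finally show ?thesis
    using that RS SR by simp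
qed

lemma norm_column_le_diam_bar: "norm (column i M) \<le> diam_bar M"
  by (simp add: diam_bar_def)

lemma one_le_spectral_norm_inverse_diam_bar:
  assumes "S ** R = mat 1"
  shows "1 \<le> spectral_norm S * diam_bar R"
proof -
  fix i
  have "S *v column i R = axis i 1"
    by (metis assms matrix_vector_mul_assoc matrix_vector_mul_lid matrix_vector_mult_basis)
  then have "1 = norm (S *v column i R)" by simp
  also have "\<dots> \<le> spectral_norm S * norm (column i R)"
    by (rule norm_mult_le_spectral_norm)
  also have "\<dots> \<le> spectral_norm S * diam_bar R"
    by (intro mult_left_mono norm_column_le_diam_bar spectral_norm_nonneg)
  finally show ?thesis .
qed

text \<open>Positivity of the constants is stated under \<open>L > 0\<close> because all three are
  multiples of \<open>L\<close> and vanish for \<open>L = 0\<close>.\<close>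

theorem theorem6:
  fixes f :: "real^'n \<Rightarrow> real" and x :: "real^'n"
    and D Q :: "real^('p::{finite,linorder})^'n" and R :: "real^('p::{finite,linorder})^('p::{finite,linorder})"
    and L \<epsilon>rad \<epsilon>geo \<Delta>min \<Delta>max \<Delta> :: real
  assumes "\<epsilon>rad \<ge> 1" and "\<epsilon>geo > 0" and "0 < \<Delta>min" and "\<Delta>min \<le> \<Delta>max"
    and "\<Delta> \<in> {\<Delta>min..\<Delta>max}"
    and "C2_plus f L"
    and "rank D = CARD('p)"
    and "is_QR_factorization D Q R"
    and "\<Delta> \<le> diam_bar R" and "diam_bar R \<le> \<epsilon>rad * \<Delta>"
    and "spectral_norm (pseudoinverse D) \<le> max (1 / \<epsilon>geo) (1 / \<Delta>min)"
  shows "let p = real CARD('p);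
             M = max (1 / \<epsilon>geo) (1 / \<Delta>min) * \<epsilon>rad * \<Delta>max;
             \<kappa>ef = (sqrt p * L * M * (6 * p * M\<^sup>2 + 2 * sqrt p * M + 3) + 2 / 3 * L) * \<epsilon>rad ^ 3;
             \<kappa>eg = 3 * sqrt p * L * M * (2 * p * M\<^sup>2 + 1) * \<epsilon>rad\<^sup>2;
             \<kappa>eh = L * (4 * p * M\<^sup>2 + 1) * \<epsilon>rad
         in Q_fully_quadratic_member f x Q \<Delta>max \<kappa>ef \<kappa>eg \<kappa>eh \<Delta>
              (simplex_model (\<lambda>s. f (x + Q *v s)) R)
            \<and> (L > 0 \<longrightarrow> \<kappa>ef > 0 \<and> \<kappa>eg > 0 \<and> \<kappa>eh > 0)"
proof -
  define p where "p = real CARD('p)"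
  define M where "M = max (1 / \<epsilon>geo) (1 / \<Delta>min) * \<epsilon>rad * \<Delta>max"
  define \<kappa>ef where "\<kappa>ef = (sqrt p * L * M * (6 * p * M\<^sup>2 + 2 * sqrt p * M + 3) + 2 / 3 * L) * \<epsilon>rad ^ 3"
  define \<kappa>eg where "\<kappa>eg = 3 * sqrt p * L * M * (2 * p * M\<^sup>2 + 1) * \<epsilon>rad\<^sup>2"
  define \<kappa>eh where "\<kappa>eh = L * (4 * p * M\<^sup>2 + 1) * \<epsilon>rad"
  define g where "g = (\<lambda>s. f (x + Q *v s))"
  define G where "G = (\<lambda>s. transpose Q *v gradient f (x + Q *v s))"
  define H where "H = (\<lambda>s. transpose Q ** hessian f (x + Q *v s) ** Q)"
  define c where "c = 2 *\<^sub>R simplex_gradient g 0 R - simplex_gradient g 0 (2 *\<^sub>R R)"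
  define A where "A = simplex_hessian g 0 R"
  define d where "d = diam_bar R"
  \<comment> \<open>\<open>e\<close> bounds both \<open>norm s\<close> and \<open>d\<close>, so
    every error becomes \<open>L\<close> times a power of \<open>e\<close> times a polynomial in
    \<open>z\<close>.\<close>
  define e where "e = \<epsilon>rad * \<Delta>"
  define z where "z = sqrt p * M"
  have Q: "transpose Q ** Q = mat 1"
    using \<open>is_QR_factorization D Q R\<close> by (simp add: is_QR_factorization_def)
  interpret lipschitz_hessian g G H L
    unfolding g_def G_def H_def by (rule lipschitz_hessian_compose[OF \<open>C2_plus f L\<close> Q])
  obtain S where S: "R ** S = mat 1" "S ** R = mat 1"
    and K: "spectral_norm S \<le> spectral_norm (pseudoinverse D)"
    using is_QR_factorization_inverse assms(7,8) by blast
  let ?K = "spectral_norm S"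
  have \<Delta>: "0 < \<Delta>" "\<Delta> \<le> \<Delta>max" "\<Delta> \<le> e"
    using assms(1,3,5) by (auto simp: e_def)
  have d: "0 < d" "d \<le> e"
    using assms \<Delta> by (auto simp: d_def e_def)
  \<comment> \<open>Relaxing \<open>\<Delta>\<close> to \<open>\<Delta>max\<close> makes the bound
    independent of the iteration.\<close>
  have "?K * d \<le> max (1 / \<epsilon>geo) (1 / \<Delta>min) * (\<epsilon>rad * \<Delta>max)"
  proof (intro mult_mono)
    show "d \<le> \<epsilon>rad * \<Delta>max"
      using d(2) mult_left_mono[OF \<Delta>(2), of \<epsilon>rad] assms(1) unfolding e_def by linarith
  qed (use K assms(2,11) d in \<open>auto simp: le_max_iff_disj\<close>)
  then have KM: "?K * d \<le> M"
    by (simp add: M_def mult.assoc)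
  have "1 \<le> ?K * d"
    using one_le_spectral_norm_inverse_diam_bar[OF S(2)] by (simp add: d_def)
  with KM have M: "1 \<le> M" by simp
  have p: "1 \<le> p"
    by (simp add: p_def Suc_le_eq)
  then have z: "1 \<le> z"
    using mult_mono[of 1 "sqrt p" 1 M] M by (simp add: z_def)
  have zz: "z\<^sup>2 = p * M\<^sup>2"
    using p by (simp add: z_def power_mult_distrib)
  have c_err: "norm (c - G 0) \<le> L * z * e\<^sup>2"
  proof -
    have "norm (c - G 0) \<le> ?K * (sqrt p * (L * d ^ 3))"
      using simplex_gradient_error[OF S norm_column_le_diam_bar] by (simp add: c_def d_def p_def)
    \<comment> \<open>Each factor \<open>?K\<close> is paired with one \<open>d\<close>, since only
      the product is bounded by \<open>M\<close>; the remaining powers of \<open>d\<close> become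
      powers of \<open>e\<close>.\<close>
    also have "\<dots> = (?K * d) * (sqrt p * L * d\<^sup>2)"
      by (simp add: power2_eq_square power3_eq_cube mult_ac)
    also have "\<dots> \<le> M * (sqrt p * L * e\<^sup>2)"
      using KM d M p L_nonneg by (intro mult_mono power_mono) auto
    finally show ?thesis by (simp add: z_def mult_ac)
  qed
  have A_err: "spectral_norm (A - H 0) \<le> L * z\<^sup>2 * e"
  proof -
    have "spectral_norm (A - H 0) \<le> ?K\<^sup>2 * (p * (L * d ^ 3))"
      using simplex_hessian_error[OF S norm_column_le_diam_bar] by (simp add: A_def d_def p_def)
    also have "\<dots> = (?K * d)\<^sup>2 * (p * L * d)"
      by (simp add: power2_eq_square power3_eq_cube mult_ac)
    also have "\<dots> \<le> M\<^sup>2 * (p * L * e)"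
      using KM d M p L_nonneg by (intro mult_mono power_mono) (auto simp: spectral_norm_nonneg)
    finally show ?thesis by (simp add: zz mult_ac)
  qed
  have m: "simplex_model g R = (\<lambda>s. g 0 + c \<bullet> s + 1 / 2 * (s \<bullet> (A *v s)))"
    by (simp add: simplex_model_def c_def A_def fun_eq_iff)
  have A_sym: "transpose A = A"
    unfolding A_def by (rule transpose_simplex_hessian[OF S])
  \<comment> \<open>The powers of \<open>\<epsilon>rad\<close> and \<open>\<Delta>\<close> merge
    into powers of \<open>e\<close>, and \<open>p\<close> and \<open>M\<close> occur only through
    \<open>z\<close>.\<close>
  have \<kappa>: "\<kappa>ef * \<Delta> ^ 3 = L * e ^ 3 * (6 * z ^ 3 + 2 * z\<^sup>2 + 3 * z + 2 / 3)"
    "\<kappa>eg * \<Delta>\<^sup>2 = L * e\<^sup>2 * (6 * z ^ 3 + 3 * z)" "\<kappa>eh * \<Delta> = L * e * (4 * z\<^sup>2 + 1)"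
  proof -
    have "\<kappa>ef = L * \<epsilon>rad ^ 3 * (z * (6 * z\<^sup>2 + 2 * z + 3) + 2 / 3)"
      unfolding \<kappa>ef_def zz by (simp add: z_def algebra_simps)
    then show "\<kappa>ef * \<Delta> ^ 3 = L * e ^ 3 * (6 * z ^ 3 + 2 * z\<^sup>2 + 3 * z + 2 / 3)"
      by (simp add: e_def power_mult_distrib) (simp add: algebra_simps power2_eq_square power3_eq_cube)
    have "\<kappa>eg = L * \<epsilon>rad\<^sup>2 * (3 * z * (2 * z\<^sup>2 + 1))"
      unfolding \<kappa>eg_def zz by (simp add: z_def algebra_simps)
    then show "\<kappa>eg * \<Delta>\<^sup>2 = L * e\<^sup>2 * (6 * z ^ 3 + 3 * z)"
      by (simp add: e_def power_mult_distrib) (simp add: algebra_simps power2_eq_square power3_eq_cube)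
    show "\<kappa>eh * \<Delta> = L * e * (4 * z\<^sup>2 + 1)"
      unfolding \<kappa>eh_def zz e_def by (simp add: algebra_simps)
  qed
  \<comment> \<open>The gradient error contains \<open>z^2\<close>, whereas
    \<open>\<kappa>eg\<close> offers only \<open>z^3\<close> and \<open>z\<close>;
    \<open>1 \<le> z\<close> lets the cube absorb the square.\<close>
  have z3: "z\<^sup>2 \<le> z ^ 3"
    using z by (intro power_increasing) auto
  have "\<bar>g s - simplex_model g R s\<bar> \<le> \<kappa>ef * \<Delta> ^ 3 \<and> norm (G s - gradient (simplex_model g R) s) \<le> \<kappa>eg * \<Delta>\<^sup>2
      \<and> spectral_norm (H s - hessian (simplex_model g R) s) \<le> \<kappa>eh * \<Delta>"
    if s: "norm s \<le> \<Delta>" for s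
  proof -
    have s: "norm s \<le> e" using s \<Delta> by simp
    have e: "0 \<le> e" using \<Delta> by simp
    have "\<bar>g s - simplex_model g R s\<bar>
        \<le> L / 6 * norm s ^ 3 + L * z * e\<^sup>2 * norm s + L * z\<^sup>2 * e / 2 * (norm s)\<^sup>2"
      unfolding m by (rule quadratic_model_error[OF c_err A_err])
    also have "\<dots> \<le> L / 6 * e ^ 3 + L * z * e\<^sup>2 * e + L * z\<^sup>2 * e / 2 * e\<^sup>2"
      using s e z L_nonneg by (intro add_mono mult_left_mono power_mono) auto
    also have "\<dots> = L * e ^ 3 * (1 / 6 + z + z\<^sup>2 / 2)"
      by (simp add: algebra_simps power2_eq_square power3_eq_cube)
    \<comment> \<open>The comparison holds coefficient by coefficient: 1/6 against 2/3, 1 against 3,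
      1/2 against 2.\<close>
    also have "\<dots> \<le> \<kappa>ef * \<Delta> ^ 3"
      unfolding \<kappa> using z z3 L_nonneg e zero_le_power2[of z] by (intro mult_left_mono) (linarith | simp)+
    finally have 1: "\<bar>g s - simplex_model g R s\<bar> \<le> \<kappa>ef * \<Delta> ^ 3" .
    have "norm (G s - gradient (simplex_model g R) s)
        \<le> L / 2 * (norm s)\<^sup>2 + L * z * e\<^sup>2 + L * z\<^sup>2 * e * norm s"
      unfolding m quadratic_gradient[OF A_sym] by (rule quadratic_model_error[OF c_err A_err])
    also have "\<dots> \<le> L / 2 * e\<^sup>2 + L * z * e\<^sup>2 + L * z\<^sup>2 * e * e"
      using s e z L_nonneg by (intro add_mono mult_left_mono power_mono) auto
    also have "\<dots> = L * e\<^sup>2 * (1 / 2 + z + z\<^sup>2)"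
      by (simp add: algebra_simps power2_eq_square)
    also have "\<dots> \<le> \<kappa>eg * \<Delta>\<^sup>2"
      unfolding \<kappa> using z z3 L_nonneg e zero_le_power2[of z] by (intro mult_left_mono) (linarith | simp)+
    finally have 2: "norm (G s - gradient (simplex_model g R) s) \<le> \<kappa>eg * \<Delta>\<^sup>2" .
    have "spectral_norm (H s - hessian (simplex_model g R) s) \<le> L * norm s + L * z\<^sup>2 * e"
      unfolding m quadratic_hessian[OF A_sym] by (rule quadratic_model_error[OF c_err A_err])
    also have "\<dots> \<le> L * e + L * z\<^sup>2 * e"
      using s L_nonneg by (intro add_mono mult_left_mono) auto
    also have "\<dots> = L * e * (z\<^sup>2 + 1)"
      by (simp add: algebra_simps)
    also have "\<dots> \<le> \<kappa>eh * \<Delta>"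
      unfolding \<kappa> using L_nonneg e by (intro mult_left_mono) auto
    finally show ?thesis using 1 2 by blast
  qed
  moreover have "C2 (simplex_model g R)"
    unfolding m by (rule C2_quadratic[OF A_sym])
  ultimately have "Q_fully_quadratic_member f x Q \<Delta>max \<kappa>ef \<kappa>eg \<kappa>eh \<Delta> (simplex_model g R)"
    using \<Delta> by (simp add: Q_fully_quadratic_member_def g_def G_def H_def del: transpose_matrix_vector)
  moreover have "\<kappa>ef > 0 \<and> \<kappa>eg > 0 \<and> \<kappa>eh > 0" if "L > 0"
    unfolding \<kappa>ef_def \<kappa>eg_def \<kappa>eh_def using that M p assms(1)
    by (auto intro!: mult_pos_pos add_pos_pos add_nonneg_pos)
  ultimately show ?thesis
    unfolding Let_def p_def M_def \<kappa>ef_def \<kappa>eg_def \<kappa>eh_def g_def by blast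
qed

end
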